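(* Let $G$ be a simple graph on $n$ vertices. Then $G$ has an $\varepsilon$-factorization if and only if, after choosing an ordering $V(G)=\{v_1,\dots,v_n\}$, there exist simple graphs $H,K$ on $V(G)$ and a matrix $E\in\{0,1\}^{n\times n}$ such that \begin{enumerate} \item $\|E\|_0\le\varepsilon n^2$; \item $\bigl(A(H)A(K)-A(G)\bigr)\odot(J-E)=0$. \end{enumerate}
   Context: All graphs are finite, simple and undirected; $N_H(u)$ is the set of neighbours of $u$ in $H$ and $A(H)$ is the adjacency matrix of $H$ with respect to the chosen ordering. Let $0\le\varepsilon\le 1$. $G$ has (admits) an $\varepsilon$-factorization if there exist simple graphs $H$ and $K$ on $V(G)$ and a set of ordered pairs $\mathcal E\subseteq V(G)\times V(G)$ with $|\mathcal E|\le\varepsilon n^2$ such that, for every $(u,v)\in (V(G)\times V(G))\setminus\mathcal E$ (including pairs with $u=v$), $|N_H(u)\cap N_K(v)|=1$ if $uv\in E(G)$ and $|N_H(u)\cap N_K(v)|=0$ otherwise. For matrices $B,C$ of the same size, $B\odot C=(b_{ij}c_{ij})$ is the Hadamard (entrywise) product; $\|M\|_0$ is the number of nonzero entries of $M$; $J=J_n$ is the $n\times n$ all-ones matrix. *)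

theory Defs
  imports
    Complex_Main
    "Graph_Theory.Pair_Digraph"
    "Jordan_Normal_Form.Matrix"
begin

text \<open>
  A finite simple undirected graph is a \<^locale>\<open>pair_graph\<close>: a finite vertex set together with a
  symmetric, loop-free set of ordered pairs of vertices. The undirected edge $uv$ is represented
  by the two pairs $(u,v)$ and $(v,u)$, so $uv \in E(G)$ is written \<open>(u, v) \<in> parcs G\<close>.
\<close>

definition nbrs :: "'a pair_pre_digraph \<Rightarrow> 'a \<Rightarrow> 'a set" where
  "nbrs H u = {w. (u, w) \<in> parcs H}"

definition simple_graph_on :: "'a set \<Rightarrow> 'a pair_pre_digraph \<Rightarrow> bool" where
  "simple_graph_on V H \<longleftrightarrow> pair_graph H \<and> pverts H = V"

definition has_eps_factorization :: "real \<Rightarrow> 'a pair_pre_digraph \<Rightarrow> bool" where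
  "has_eps_factorization \<epsilon> G \<longleftrightarrow>
     (\<exists>H K X. simple_graph_on (pverts G) H \<and> simple_graph_on (pverts G) K \<and>
        X \<subseteq> pverts G \<times> pverts G \<and>
        real (card X) \<le> \<epsilon> * (real (card (pverts G)))\<^sup>2 \<and>
        (\<forall>(u, v) \<in> (pverts G \<times> pverts G) - X.
           card (nbrs H u \<inter> nbrs K v) = (if (u, v) \<in> parcs G then 1 else 0)))"

text \<open>An ordering $v_1,\dots,v_n$ of a finite set, as a list (so indices start from 0).\<close>

definition is_ordering :: "'a list \<Rightarrow> 'a set \<Rightarrow> bool" where
  "is_ordering vs V \<longleftrightarrow> distinct vs \<and> set vs = V"

definition adj_mat :: "'a list \<Rightarrow> 'a pair_pre_digraph \<Rightarrow> real mat" where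
  "adj_mat vs H =
     mat (length vs) (length vs) (\<lambda>(i, j). if (vs ! i, vs ! j) \<in> parcs H then 1 else 0)"

text \<open>As with the library's matrix addition, the dimensions are taken from the right operand;
  the operation is meant for operands of equal size.\<close>

definition hadamard_prod :: "'b :: times mat \<Rightarrow> 'b mat \<Rightarrow> 'b mat" (infixl \<open>\<odot>\<^sub>m\<close> 70) where
  "B \<odot>\<^sub>m C = mat (dim_row C) (dim_col C) (\<lambda>(i, j). B $$ (i, j) * C $$ (i, j))"

definition zero_norm :: "'b :: zero mat \<Rightarrow> nat" where
  "zero_norm M = card {(i, j). i < dim_row M \<and> j < dim_col M \<and> M $$ (i, j) \<noteq> 0}"

definition ones_mat :: "nat \<Rightarrow> 'b :: one mat" where
  "ones_mat n = mat n n (\<lambda>_. 1)"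

end

theory Submission
  imports Defs
begin

text \<open>
  The $(i,j)$ entry of $A(H)A(K)$ sums, over all vertices $w$, the product of the indicators of
  $v_i w \<in> E(H)$ and $w v_j \<in> E(K)$. Because $K$ is undirected, this counts the common
  neighbours $|N_H(v_i) \<inter> N_K(v_j)|$. Being a factorization at the pair $(v_i,v_j)$ is therefore
  the same as $A(H)A(K)$ and $A(G)$ agreeing at the entry $(i,j)$
  (\<open>adj_mat_mult_index\<close>, \<open>hadamard_prod_exception_mat\<close>).

  The exceptional set and the matrix $E$ carry the same information: $E$ is the indicator matrix
  of a set of ordered pairs, every $0/1$ matrix arises in this way, and the number of
  nonzero entries is the number of pairs
  (\<open>zero_one_mat_is_exception_mat\<close>, \<open>zero_norm_exception_mat\<close>). Multiplying entrywise by $J-E$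
  imposes the equation exactly outside the exceptional set.
\<close>

lemma bij_betw_nth_pairs:
  assumes "is_ordering vs V"
  shows "bij_betw (\<lambda>(i, j). (vs ! i, vs ! j)) ({..<length vs} \<times> {..<length vs}) (V \<times> V)"
proof -
  have "bij_betw ((!) vs) {..<length vs} V"
    using assms by (auto simp: is_ordering_def intro: bij_betw_nth)
  from bij_betw_map_prod[OF this this] show ?thesis
    by (simp add: map_prod_def)
qed

text \<open>The second factor contributes arcs ending in $v_j$, whereas \<^const>\<open>nbrs\<close> collects
  arcs starting there; hence the symmetry of $K$.\<close>

lemma adj_mat_mult_index:
  assumes ord: "is_ordering vs V"
    and H: "simple_graph_on V H" and K: "simple_graph_on V K"
    and i: "i < length vs" and j: "j < length vs"
  shows "(adj_mat vs H * adj_mat vs K) $$ (i, j)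
    = real (card (nbrs H (vs ! i) \<inter> nbrs K (vs ! j)))"
proof -
  interpret H: pair_graph H using H by (simp add: simple_graph_on_def)
  interpret K: pair_graph K using K by (simp add: simple_graph_on_def)
  let ?N = "nbrs H (vs ! i) \<inter> nbrs K (vs ! j)"
  have bij: "bij_betw ((!) vs) {..<length vs} V"
    using ord by (auto simp: is_ordering_def intro: bij_betw_nth)
  have sub: "?N \<subseteq> V"
    using H by (force simp: nbrs_def simple_graph_on_def dest: H.in_arcsD2)
  have fin: "finite V"
    using ord by (auto simp: is_ordering_def)
  have "(adj_mat vs H * adj_mat vs K) $$ (i, j)
      = (\<Sum>k<length vs. (if (vs ! i, vs ! k) \<in> parcs H then 1 else 0)
          * (if (vs ! k, vs ! j) \<in> parcs K then 1 else 0))"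
    using i j by (simp add: adj_mat_def scalar_prod_def lessThan_atLeast0)
  also have "\<dots> = (\<Sum>k<length vs. if vs ! k \<in> ?N then 1 else 0)"
    using K.arcs_symmetric by (intro sum.cong) (auto simp: nbrs_def)
  also have "\<dots> = (\<Sum>w\<in>V. if w \<in> ?N then 1 else 0)"
    using sum.reindex_bij_betw[OF bij] by fast
  also have "\<dots> = real (card (V \<inter> ?N))"
    using fin by (simp add: sum.If_cases Int_def)
  also have "V \<inter> ?N = ?N" using sub by blast
  finally show ?thesis .
qed

definition exception_mat :: "'a list \<Rightarrow> ('a \<times> 'a) set \<Rightarrow> real mat" where
  "exception_mat vs X =
     mat (length vs) (length vs) (\<lambda>(i, j). if (vs ! i, vs ! j) \<in> X then 1 else 0)"

lemma exception_mat_carrier: "exception_mat vs X \<in> carrier_mat (length vs) (length vs)"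
  by (simp add: exception_mat_def)

lemma elements_exception_mat: "elements_mat (exception_mat vs X) \<subseteq> {0, 1}"
  by (auto simp: exception_mat_def elements_mat_def)

lemma zero_norm_exception_mat:
  assumes ord: "is_ordering vs V" and X: "X \<subseteq> V \<times> V"
  shows "zero_norm (exception_mat vs X) = card X"
proof -
  let ?f = "\<lambda>(i, j). (vs ! i, vs ! j)"
  let ?I = "{..<length vs} \<times> {..<length vs}"
  have "{(i, j). i < length vs \<and> j < length vs \<and> exception_mat vs X $$ (i, j) \<noteq> 0}
      = ?f -` X \<inter> ?I"
    by (auto simp: exception_mat_def split: if_splits)
  then have "zero_norm (exception_mat vs X) = card (?f -` X \<inter> ?I)"
    by (simp add: zero_norm_def exception_mat_def)
  also have "\<dots> = card X"
  proof (rule bij_betw_same_card)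
    have "?f ` (?f -` X \<inter> ?I) = X \<inter> ?f ` ?I"
      by auto
    also have "\<dots> = X"
      unfolding bij_betw_imp_surj_on[OF bij_betw_nth_pairs[OF ord]] using X by (rule Int_absorb2)
    finally have "?f ` (?f -` X \<inter> ?I) = X" .
    then show "bij_betw ?f (?f -` X \<inter> ?I) X"
      by (rule bij_betw_subset[OF bij_betw_nth_pairs[OF ord] Int_lower2])
  qed
  finally show ?thesis .
qed

lemma zero_one_mat_is_exception_mat:
  fixes E :: "real mat"
  assumes ord: "is_ordering vs V" and E: "E \<in> carrier_mat (length vs) (length vs)"
    and E01: "elements_mat E \<subseteq> {0, 1}"
  obtains X where "X \<subseteq> V \<times> V" and "E = exception_mat vs X"
proof
  let ?f = "\<lambda>(i, j). (vs ! i, vs ! j)"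
  let ?I = "{..<length vs} \<times> {..<length vs}"
  let ?S = "{p \<in> ?I. E $$ p \<noteq> 0}"
  have bij: "bij_betw ?f ?I (V \<times> V)" by (rule bij_betw_nth_pairs[OF ord])
  show "?f ` ?S \<subseteq> V \<times> V"
    using bij by (auto simp: bij_betw_def)
  have mem: "(vs ! i, vs ! j) \<in> ?f ` ?S \<longleftrightarrow> E $$ (i, j) \<noteq> 0"
    if "i < length vs" "j < length vs" for i j
    using inj_on_image_mem_iff[of ?f ?I "(i, j)" ?S] bij that by (auto simp: bij_betw_def)
  have "E $$ (i, j) \<in> {0, 1}" if "i < length vs" "j < length vs" for i j
    using elements_matI[OF E that refl] E01 by (rule set_mp[rotated])
  \<comment> \<open>Membership in the image must stay folded, so that injectivity of the ordering enters only via \<open>mem\<close>.\<close>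
  then show "E = exception_mat vs (?f ` ?S)"
    using E mem by (intro eq_matI) (auto simp: exception_mat_def simp del: image_iff)
qed

lemma hadamard_prod_exception_mat:
  assumes ord: "is_ordering vs V"
    and H: "simple_graph_on V H" and K: "simple_graph_on V K"
  shows "(adj_mat vs H * adj_mat vs K - adj_mat vs G)
        \<odot>\<^sub>m (ones_mat (length vs) - exception_mat vs X) = 0\<^sub>m (length vs) (length vs)
    \<longleftrightarrow> (\<forall>(u, v) \<in> (V \<times> V) - X.
          card (nbrs H u \<inter> nbrs K v) = (if (u, v) \<in> parcs G then 1 else 0))"
    (is "?M = 0\<^sub>m ?n ?n \<longleftrightarrow> (\<forall>(u, v) \<in> _. ?P u v)")
proof -
  have entry: "?M $$ (i, j) = 0 \<longleftrightarrow> (vs ! i, vs ! j) \<in> X \<or> ?P (vs ! i) (vs ! j)"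
    if "i < ?n" "j < ?n" for i j
  proof -
    have "?M $$ (i, j) = ((adj_mat vs H * adj_mat vs K) $$ (i, j) - adj_mat vs G $$ (i, j))
        * (1 - exception_mat vs X $$ (i, j))"
      using that
      by (simp add: hadamard_prod_def ones_mat_def exception_mat_def adj_mat_def)
    then show ?thesis
      unfolding adj_mat_mult_index[OF ord H K that]
      using that by (simp add: exception_mat_def adj_mat_def)
  qed
  have "?M = 0\<^sub>m ?n ?n \<longleftrightarrow> (\<forall>i<?n. \<forall>j<?n. ?M $$ (i, j) = 0)"
    by (auto simp: mat_eq_iff hadamard_prod_def exception_mat_def)
  also have "\<dots> \<longleftrightarrow> (\<forall>i<?n. \<forall>j<?n. (vs ! i, vs ! j) \<in> X \<or> ?P (vs ! i) (vs ! j))"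
    using entry by blast
  also have "\<dots> \<longleftrightarrow> (\<forall>u\<in>V. \<forall>v\<in>V. (u, v) \<in> X \<or> ?P u v)"
    using ord unfolding is_ordering_def by (metis in_set_conv_nth)
  also have "\<dots> \<longleftrightarrow> (\<forall>(u, v) \<in> (V \<times> V) - X. ?P u v)"
    by blast
  finally show ?thesis .
qed

theorem lemma1:
  fixes G :: "'a pair_pre_digraph" and n :: nat and \<epsilon> :: real and vs :: "'a list"
  assumes "pair_graph G" and "card (pverts G) = n"
    and "0 \<le> \<epsilon>" and "\<epsilon> \<le> 1"
    and "is_ordering vs (pverts G)"
  shows "has_eps_factorization \<epsilon> G \<longleftrightarrow>
    (\<exists>H K. \<exists>E \<in> carrier_mat n n.
       simple_graph_on (pverts G) H \<and> simple_graph_on (pverts G) K \<and>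
       elements_mat E \<subseteq> {0, 1} \<and>
       real (zero_norm E) \<le> \<epsilon> * (real n)\<^sup>2 \<and>
       (adj_mat vs H * adj_mat vs K - adj_mat vs G) \<odot>\<^sub>m (ones_mat n - E) = 0\<^sub>m n n)"
proof -
  let ?V = "pverts G"
  have ord: "is_ordering vs ?V" by fact
  have n: "length vs = n"
    using assms(2) ord distinct_card[of vs] by (simp add: is_ordering_def)
  show ?thesis
  proof
    assume "has_eps_factorization \<epsilon> G"
    then obtain H K X where HK: "simple_graph_on ?V H" "simple_graph_on ?V K"
      and X: "X \<subseteq> ?V \<times> ?V" and card: "real (card X) \<le> \<epsilon> * (real n)\<^sup>2"
      and fact: "\<forall>(u, v) \<in> (?V \<times> ?V) - X.
        card (nbrs H u \<inter> nbrs K v) = (if (u, v) \<in> parcs G then 1 else 0)"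
      unfolding has_eps_factorization_def assms(2) by blast
    show "\<exists>H K. \<exists>E \<in> carrier_mat n n.
       simple_graph_on (pverts G) H \<and> simple_graph_on (pverts G) K \<and>
       elements_mat E \<subseteq> {0, 1} \<and>
       real (zero_norm E) \<le> \<epsilon> * (real n)\<^sup>2 \<and>
       (adj_mat vs H * adj_mat vs K - adj_mat vs G) \<odot>\<^sub>m (ones_mat n - E) = 0\<^sub>m n n"
      using HK card fact hadamard_prod_exception_mat[OF ord HK, of G X]
        exception_mat_carrier[of vs X] elements_exception_mat[of vs X]
        zero_norm_exception_mat[OF ord X]
      unfolding n by (intro exI[of _ H] exI[of _ K] bexI[of _ "exception_mat vs X"]) auto
  next
    assume "\<exists>H K. \<exists>E \<in> carrier_mat n n.
       simple_graph_on (pverts G) H \<and> simple_graph_on (pverts G) K \<and>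
       elements_mat E \<subseteq> {0, 1} \<and>
       real (zero_norm E) \<le> \<epsilon> * (real n)\<^sup>2 \<and>
       (adj_mat vs H * adj_mat vs K - adj_mat vs G) \<odot>\<^sub>m (ones_mat n - E) = 0\<^sub>m n n"
    then obtain H K E where HK: "simple_graph_on ?V H" "simple_graph_on ?V K"
      and E: "E \<in> carrier_mat n n" "elements_mat E \<subseteq> {0, 1}"
      and norm: "real (zero_norm E) \<le> \<epsilon> * (real n)\<^sup>2"
      and eq: "(adj_mat vs H * adj_mat vs K - adj_mat vs G) \<odot>\<^sub>m (ones_mat n - E) = 0\<^sub>m n n"
      by blast
    obtain X where X: "X \<subseteq> ?V \<times> ?V" and EX: "E = exception_mat vs X"
      using zero_one_mat_is_exception_mat[OF ord] E n by blast
    have "\<forall>(u, v) \<in> (?V \<times> ?V) - X.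
        card (nbrs H u \<inter> nbrs K v) = (if (u, v) \<in> parcs G then 1 else 0)"
      using hadamard_prod_exception_mat[OF ord HK, of G X] eq unfolding EX n by blast
    moreover have "real (card X) \<le> \<epsilon> * (real n)\<^sup>2"
      using norm zero_norm_exception_mat[OF ord X] by (simp add: EX)
    ultimately show "has_eps_factorization \<epsilon> G"
      unfolding has_eps_factorization_def assms(2) using HK X by blast
  qed
qed

end
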